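(* Let $X,\Omega$ be sets, let $(\mathcal{U},\mathcal{U}^\diamond)$ be a dual pair of Banach spaces and let $\mathcal{B}$ be a vv-RKBS containing functions mapping $X$ to $\mathcal{U}$. Assume that $\mathcal{B}^\diamond$ is a Banach space of functions mapping $\Omega$ to $\mathcal{U}^\diamond$. Then the following statements are equivalent: 1. $\mathcal{B}^\diamond$ is isometrically embedded in $\mathcal{B}^*$. 2. There exists a duality pairing $\langle\cdot,\cdot\rangle_{\mathcal{B}}\colon\mathcal{B}^\diamond\times\mathcal{B}\to\mathbb{R}$ and the norm $\|\cdot\|_{\mathcal{B}^\diamond}$ satisfies $\|g\|_{\mathcal{B}^\diamond}=\sup_{\|f\|_{\mathcal{B}}\le1}|\langle g,f\rangle_{\mathcal{B}}|$. Moreover, let $\delta_{x,u^\diamond}(f):=\langle u^\diamond,f(x)\rangle_{\mathcal{U}}$ for $f\in\mathcal{B}$, let $\Delta:=\operatorname{span}\{\delta_{x,u^\diamond} : (x,u^\diamond)\in X\times\mathcal{U}^\diamond\}$, and let the $\delta$-dual be defined as the closure $\overline{\Delta}$ of $\Delta$ under the $\mathcal{B}^*$ norm. Then the following are also equivalent: 3. $\Delta\subseteq\mathcal{B}^*$ and the $\delta$-dual $\overline{\Delta}\subseteq\mathcal{B}^*$ is isometrically isomorphic to $\mathcal{B}^\diamond$. 4. (a) There exists a duality pairing $\langle\cdot,\cdot\rangle_{\mathcal{B}}\colon\mathcal{B}^\diamond\times\mathcal{B}\to\mathbb{R}$; (b) the norm $\|\cdot\|_{\mathcal{B}^\diamond}$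 satisfies $\|g\|_{\mathcal{B}^\diamond}=\sup_{\|f\|_{\mathcal{B}}\le1}|\langle g,f\rangle_{\mathcal{B}}|$; (c) there exists a map $K_{\mathcal{U}^\diamond}$ that assigns to each $(x,w)\in X\times\Omega$ a linear operator $K_{\mathcal{U}^\diamond}(x,w)\colon\mathcal{U}^\diamond\to\mathcal{U}^\diamond$ such that for all $x\in X$, $u^\diamond\in\mathcal{U}^\diamond$ and $f\in\mathcal{B}$ the function $K_{\mathcal{U}^\diamond}(x,\cdot)u^\diamond$ belongs to $\mathcal{B}^\diamond$ and $\langle u^\diamond,f(x)\rangle_{\mathcal{U}}=\langle K_{\mathcal{U}^\diamond}(x,\cdot)u^\diamond,f\rangle_{\mathcal{B}}$; and (d) the set $\operatorname{span}\{K_{\mathcal{U}^\diamond}(x,\cdot)u^\diamond \mid (x,u^\diamond)\in X\times\mathcal{U}^\diamond\}$ is dense in $\mathcal{B}^\diamond$.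
   Context: All vector spaces are real; $\mathcal{B}^*$ is the continuous dual of $\mathcal{B}$. vv-RKBS: a Banach space $\mathcal{B}$ of functions from a set $X$ to a Banach space $\mathcal{U}$ (with pointwise vector operations) such that for every $x\in X$ there is $C_x\ge0$ with $\|f(x)\|_{\mathcal{U}}\le C_x\|f\|_{\mathcal{B}}$ for all $f\in\mathcal{B}$. Dual pair / duality pairing: a dual pair of Banach spaces $(E,E^\diamond)$ consists of two Banach spaces and a bilinear map $\langle\cdot,\cdot\rangle_E\colon E^\diamond\times E\to\mathbb{R}$ (the duality pairing) such that $\langle g,f\rangle_E=0$ for all $g\in E^\diamond$ implies $f=0$, and $\langle g,f\rangle_E=0$ for all $f\in E$ implies $g=0$. $\langle\cdot,\cdot\rangle_{\mathcal{U}}\colon\mathcal{U}^\diamond\times\mathcal{U}\to\mathbb{R}$ denotes the pairing of $(\mathcal{U},\mathcal{U}^\diamond)$.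
   Formalization: In statement 1 the isometric embedding of B^⋄ in B^* is also required to have a range separating the points of B; without this, 1 ⇒ 2 fails (e.g. B^⋄ = {0}, B ≠ {0}), since a duality pairing must be non-degenerate in f. *)

theory Defs
  imports "HOL-Analysis.Analysis" "HOL-Library.Function_Algebras"
begin

text \<open>
  A Banach space of functions on a set \<open>X\<close> is rendered as a Banach space type together with the
  evaluation map \<open>ev\<close>, where \<open>ev f x\<close> is the value at \<open>x\<close> of the function \<open>f\<close>: an element
  is determined by its values on \<open>X\<close>, and the vector operations are the pointwise ones.  Values
  outside \<open>X\<close> are irrelevant.
\<close>

definition banach_function_space ::
    "'x set \<Rightarrow> ('b::banach \<Rightarrow> 'x \<Rightarrow> 'u::banach) \<Rightarrow> bool" where
  "banach_function_space X ev \<longleftrightarrow>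
     (\<forall>f g. (\<forall>x\<in>X. ev f x = ev g x) \<longrightarrow> f = g) \<and> (\<forall>x\<in>X. linear (\<lambda>f. ev f x))"

definition vv_RKBS :: "'x set \<Rightarrow> ('b::banach \<Rightarrow> 'x \<Rightarrow> 'u::banach) \<Rightarrow> bool" where
  "vv_RKBS X ev \<longleftrightarrow>
     banach_function_space X ev \<and> (\<forall>x\<in>X. \<exists>C\<ge>0. \<forall>f. norm (ev f x) \<le> C * norm f)"

text \<open>The pairing is not assumed to be continuous.\<close>

definition duality_pairing :: "('d::banach \<Rightarrow> 'e::banach \<Rightarrow> real) \<Rightarrow> bool" where
  "duality_pairing p \<longleftrightarrow> bilinear p \<and>
     (\<forall>f. (\<forall>g. p g f = 0) \<longrightarrow> f = 0) \<and> (\<forall>g. (\<forall>f. p g f = 0) \<longrightarrow> g = 0)"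

text \<open>The supremum is taken in the extended reals, so that its finiteness is part of the condition.\<close>

definition norm_is_dual_norm :: "('d::banach \<Rightarrow> 'e::banach \<Rightarrow> real) \<Rightarrow> bool" where
  "norm_is_dual_norm p \<longleftrightarrow>
     (\<forall>g. ereal (norm g) = (SUP f\<in>{f. norm f \<le> 1}. ereal \<bar>p g f\<bar>))"

definition linear_isometry :: "('a::real_normed_vector \<Rightarrow> 'b::real_normed_vector) \<Rightarrow> bool" where
  "linear_isometry T \<longleftrightarrow> linear T \<and> (\<forall>g. norm (T g) = norm g)"

text \<open>
  A duality pairing is non-degenerate in both arguments, and a linear isometry of \<open>'d\<close> into the
  continuous dual of \<open>'e\<close> yields one only if its range separates the points of \<open>'e\<close>: the zero
  space embeds isometrically into every dual, but is in duality with the zero space only.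
\<close>

definition separates_points ::
    "('d::real_normed_vector \<Rightarrow> ('e::real_normed_vector \<Rightarrow>\<^sub>L real)) \<Rightarrow> bool" where
  "separates_points T \<longleftrightarrow> (\<forall>f. (\<forall>g. blinfun_apply (T g) f = 0) \<longrightarrow> f = 0)"

definition delta :: "('v \<Rightarrow> 'u \<Rightarrow> real) \<Rightarrow> ('b \<Rightarrow> 'x \<Rightarrow> 'u) \<Rightarrow> 'x \<Rightarrow> 'v \<Rightarrow> ('b \<Rightarrow> real)" where
  "delta pU ev x u = (\<lambda>f. pU u (ev f x))"

text \<open>
  The span is taken in the vector space of all functions \<open>'b \<Rightarrow> real\<close>; continuity of its elements
  is not presupposed.
\<close>

definition Delta ::
    "'x set \<Rightarrow> ('v \<Rightarrow> 'u \<Rightarrow> real) \<Rightarrow> ('b \<Rightarrow> 'x \<Rightarrow> 'u) \<Rightarrow> ('b \<Rightarrow> real) set" where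
  "Delta X pU ev = module.span (\<lambda>c \<phi> f. c * \<phi> f) {delta pU ev x u | x u. x \<in> X}"

definition delta_dual ::
    "'x set \<Rightarrow> ('v \<Rightarrow> 'u \<Rightarrow> real) \<Rightarrow> ('b::real_normed_vector \<Rightarrow> 'x \<Rightarrow> 'u) \<Rightarrow> ('b \<Rightarrow>\<^sub>L real) set" where
  "delta_dual X pU ev = closure {\<phi>. blinfun_apply \<phi> \<in> Delta X pU ev}"

end

theory Submission
  imports Defs
begin

text \<open>
  A pairing whose norm is the dual norm is the same thing as a linear isometry
  \<open>T\<close> into the continuous dual whose range separates points, via \<open>p g f = T g f\<close>.  Under this
  correspondence the reproducing property says \<open>T (k x u) = \<delta>\<^sub>x\<^sub>,\<^sub>u\<close>, so
  \<open>T\<close> maps the span of the kernel sections onto \<open>\<Delta>\<close>; as \<open>T\<close> is an isometry on a complete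
  space it commutes with closures, and density of the kernel sections becomes
  \<open>range T = closure \<Delta>\<close>.
\<close>

text \<open>A nonzero \<open>f\<close> is rescaled to norm 1 and \<open>h\<close> is homogeneous.
  Only linearity of \<open>h\<close> is assumed, so a finite supremum over the unit ball yields
  continuity.\<close>

lemma abs_le_SUP_unit_ball:
  fixes h :: "'a::real_normed_vector \<Rightarrow> real"
  assumes "linear h" and le: "(SUP f\<in>{f. norm f \<le> 1}. ereal \<bar>h f\<bar>) \<le> ereal r"
  shows "\<bar>h f\<bar> \<le> r * norm f"
proof (cases "f = 0")
  case True
  then show ?thesis using linear_0[OF \<open>linear h\<close>] by simp
next
  case False
  have "ereal \<bar>h (f /\<^sub>R norm f)\<bar> \<le> (SUP f\<in>{f. norm f \<le> 1}. ereal \<bar>h f\<bar>)"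
    using False by (intro SUP_upper) simp
  from order_trans[OF this le] have "\<bar>h (f /\<^sub>R norm f)\<bar> \<le> r"
    by (simp only: ereal_less_eq)
  moreover have "h (f /\<^sub>R norm f) = h f / norm f"
    by (simp add: linear_scale[OF \<open>linear h\<close>] divide_inverse mult.commute)
  ultimately show ?thesis
    using False by (simp add: pos_divide_le_eq)
qed

text \<open>This puts the operator norm in the form used by \<open>norm_is_dual_norm\<close>. The
  supremum is below the norm by the operator bound, and it is itself an admissible bound constant by
  \<open>abs_le_SUP_unit_ball\<close>.\<close>

lemma ereal_norm_blinfun_eq_SUP:
  fixes \<phi> :: "'a::real_normed_vector \<Rightarrow>\<^sub>L real"
  shows "ereal (norm \<phi>) = (SUP f\<in>{f. norm f \<le> 1}. ereal \<bar>blinfun_apply \<phi> f\<bar>)"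
    (is "_ = ?s")
proof (rule antisym)
  have lin: "linear (blinfun_apply \<phi>)"
    by (simp add: bounded_linear.linear blinfun.bounded_linear_right)
  show s_le: "?s \<le> ereal (norm \<phi>)"
  proof (rule SUP_least)
    fix f :: 'a assume "f \<in> {f. norm f \<le> 1}"
    then have "norm \<phi> * norm f \<le> norm \<phi>"
      by (simp add: mult_left_le)
    with norm_blinfun[of \<phi> f] show "ereal \<bar>blinfun_apply \<phi> f\<bar> \<le> ereal (norm \<phi>)"
      by simp
  qed
  \<comment> \<open>The vector 0 lies in the unit ball. With \<open>s_le\<close> this makes the
    supremum a nonnegative real, hence usable as a bound constant.\<close>
  have s_ge: "0 \<le> ?s"
    by (rule SUP_upper2[where i = 0]) simp_all
  with s_le obtain r where r: "?s = ereal r"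
    by (cases ?s) auto
  have "norm \<phi> \<le> r"
  proof (rule norm_blinfun_bound)
    show "0 \<le> r" using s_ge r by simp
    show "norm (blinfun_apply \<phi> f) \<le> r * norm f" for f
      using abs_le_SUP_unit_ball[OF lin, of r f] r by simp
  qed
  then show "ereal (norm \<phi>) \<le> ?s" using r by simp
qed

text \<open>Nondegeneracy in \<open>g\<close> holds because an isometry has trivial kernel;
  nondegeneracy in \<open>f\<close> is precisely \<open>separates_points\<close>.\<close>

lemma linear_isometry_imp_pairing:
  fixes T :: "'d::banach \<Rightarrow> ('b::banach \<Rightarrow>\<^sub>L real)"
  assumes "linear_isometry T" and "separates_points T"
  shows "duality_pairing (\<lambda>g. blinfun_apply (T g))"
    and "norm_is_dual_norm (\<lambda>g. blinfun_apply (T g))"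
proof -
  have lin: "linear T" and norm_T: "\<And>g. norm (T g) = norm g"
    using assms(1) by (auto simp: linear_isometry_def)
  have "bilinear (\<lambda>g. blinfun_apply (T g))"
    unfolding bilinear_def
    by (auto intro!: linearI simp: linear_add[OF lin] linear_scale[OF lin] blinfun.bilinear_simps)
  moreover have "g = 0" if "\<forall>f. blinfun_apply (T g) f = 0" for g
  proof -
    have "T g = 0" using that by (intro blinfun_eqI) simp
    then show ?thesis using norm_T[of g] by simp
  qed
  ultimately show "duality_pairing (\<lambda>g. blinfun_apply (T g))"
    using assms(2) by (auto simp: duality_pairing_def separates_points_def)
  show "norm_is_dual_norm (\<lambda>g. blinfun_apply (T g))"
    unfolding norm_is_dual_norm_def by (metis ereal_norm_blinfun_eq_SUP norm_T)
qed

lemma pairing_obtains_linear_isometry: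
  fixes p :: "'d::banach \<Rightarrow> 'b::banach \<Rightarrow> real"
  assumes "duality_pairing p" and "norm_is_dual_norm p"
  obtains T :: "'d \<Rightarrow> ('b \<Rightarrow>\<^sub>L real)"
  where "linear_isometry T" and "separates_points T" and "\<And>g f. blinfun_apply (T g) f = p g f"
proof
  \<comment> \<open>\<open>Blinfun\<close> is meaningful only on bounded linear maps. Boundedness of
    \<open>p g\<close>, with constant \<open>norm g\<close>, is extracted below from the dual norm
    condition.\<close>
  define T where "T g = Blinfun (p g)" for g
  have lin1: "linear (p g)" and lin2: "linear (\<lambda>g. p g f)" for g f
    using assms(1) by (auto simp: duality_pairing_def bilinear_def)
  have dual: "ereal (norm g) = (SUP f\<in>{f. norm f \<le> 1}. ereal \<bar>p g f\<bar>)" for g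
    using assms(2) by (auto simp: norm_is_dual_norm_def)
  have "bounded_linear (p g)" for g
    using abs_le_SUP_unit_ball[OF lin1, of g "norm g"] dual[of g]
    by (intro bounded_linear_intro[of _ "norm g"])
      (auto simp: linear_add[OF lin1] linear_scale[OF lin1] mult.commute)
  then show T: "blinfun_apply (T g) f = p g f" for g f
    by (simp add: T_def bounded_linear_Blinfun_apply)
  have "linear T"
    by (intro linearI blinfun_eqI)
      (simp_all add: T blinfun.bilinear_simps linear_add[OF lin2] linear_scale[OF lin2])
  moreover have "norm (T g) = norm g" for g
  proof -
    have "ereal (norm (T g)) = ereal (norm g)"
      unfolding dual ereal_norm_blinfun_eq_SUP T ..
    then show ?thesis by simp
  qed
  ultimately show "linear_isometry T" by (simp add: linear_isometry_def)
  show "separates_points T"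
    using assms(1) by (auto simp: separates_points_def duality_pairing_def T)
qed

lemma linear_isometry_inj:
  assumes "linear_isometry T"
  shows "inj T"
proof -
  have "linear T" and "\<And>g. norm (T g) = norm g"
    using assms by (auto simp: linear_isometry_def)
  then show ?thesis by (metis linear_injective_0 norm_eq_zero)
qed

lemma closure_linear_isometry_image:
  fixes T :: "'a::banach \<Rightarrow> 'b::real_normed_vector"
  assumes "linear_isometry T"
  shows "closure (T ` A) = T ` closure A"
proof (rule antisym)
  have lin: "linear T" and norm_T: "\<And>g. norm (T g) = norm g"
    using assms by (auto simp: linear_isometry_def)
  have bl: "bounded_linear T"
    using lin norm_T by (intro bounded_linear_intro[of _ 1]) (auto simp: linear_add linear_scale)
  have dist_T: "dist (T x) (T y) = dist x y" for x y
    by (simp add: dist_norm norm_T flip: linear_diff[OF lin])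
  have "complete (range T)"
    using complete_isometric_image[of 1 UNIV T] bl norm_T by (simp add: complete_UNIV)
  then have "closure (T ` A) \<subseteq> range T"
    by (intro closure_minimal complete_imp_closed) auto
  then show "closure (T ` A) \<subseteq> T ` closure A"
    by (auto simp: closure_approachable dist_T)
  show "T ` closure A \<subseteq> closure (T ` A)"
    using bl by (rule closure_bounded_linear_image_subset)
qed

text \<open>The explicit scaling is the one in \<open>Delta\<close>, so the general facts on spans
  in a module apply there.\<close>

lemma module_real_functions: "module (\<lambda>(c::real) (\<phi> :: 'a \<Rightarrow> real) f. c * \<phi> f)"
  by unfold_locales (auto simp: fun_eq_iff algebra_simps)

lemma module_hom_blinfun_apply:
  fixes T :: "'d::real_vector \<Rightarrow> ('b::real_normed_vector \<Rightarrow>\<^sub>L real)"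
  assumes "linear T"
  shows "module_hom scaleR (\<lambda>c \<phi> f. c * \<phi> f) (\<lambda>g. blinfun_apply (T g))"
  using module_real_functions
  by (auto simp: module_hom_iff module_axioms real_vector.module_axioms fun_eq_iff
      linear_add[OF assms] linear_scale[OF assms] blinfun.bilinear_simps)

text \<open>By \<open>repr\<close> the functionals \<open>delta\<close> are the images of the kernel
  sections \<open>k x u\<close>, and a module homomorphism maps spans onto spans. In particular
  \<open>Delta\<close> then consists of continuous functionals.\<close>

lemma Delta_eq_image_span:
  fixes T :: "'d::real_vector \<Rightarrow> ('b::real_normed_vector \<Rightarrow>\<^sub>L real)"
  assumes "linear T"
    and repr: "\<And>x u f. x \<in> X \<Longrightarrow> pU u (ev f x) = blinfun_apply (T (k x u)) f"
  shows "Delta X pU ev = (\<lambda>g. blinfun_apply (T g)) ` span {k x u | x u. x \<in> X}"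
proof -
  have "{delta pU ev x u | x u. x \<in> X} = (\<lambda>g. blinfun_apply (T g)) ` {k x u | x u. x \<in> X}"
  proof -
    have "delta pU ev x u = blinfun_apply (T (k x u))" if "x \<in> X" for x u
      using repr[OF that] by (auto simp: delta_def)
    then show ?thesis by (auto intro!: imageI) metis
  qed
  then show ?thesis
    unfolding Delta_def
    using module_hom.span_image[OF module_hom_blinfun_apply[OF \<open>linear T\<close>]] by (simp add: span_raw_def)
qed

text \<open>Injectivity of \<open>blinfun_apply\<close> moves the description of
  \<open>Delta\<close> from plain functions into the continuous dual, where the isometry commutes
  with closure.\<close>

lemma delta_dual_eq_image_closure:
  fixes T :: "'d::banach \<Rightarrow> ('b::real_normed_vector \<Rightarrow>\<^sub>L real)"
  assumes "linear_isometry T"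
    and "\<And>x u f. x \<in> X \<Longrightarrow> pU u (ev f x) = blinfun_apply (T (k x u)) f"
  shows "delta_dual X pU ev = T ` closure (span {k x u | x u. x \<in> X})"
proof -
  have "linear T" using assms(1) by (simp add: linear_isometry_def)
  from Delta_eq_image_span[of T X pU ev k, OF this assms(2)]
  have "{\<phi>. blinfun_apply \<phi> \<in> Delta X pU ev} = T ` span {k x u | x u. x \<in> X}"
    by (auto simp: blinfun_apply_inject)
  then show ?thesis
    by (simp add: delta_dual_def closure_linear_isometry_image[OF assms(1)])
qed

text \<open>As \<open>T\<close> is injective, linearity may be tested after applying
  \<open>T\<close> and evaluating at \<open>f\<close>, where it is linearity of \<open>q\<close> in
  its first argument. In the application \<open>e\<close> is evaluation at a fixed point.\<close>

lemma linear_kernel_section: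
  fixes T :: "'d::real_normed_vector \<Rightarrow> ('b::real_normed_vector \<Rightarrow>\<^sub>L real)"
  assumes "linear_isometry T" and "\<And>y. linear (\<lambda>u. q u y)"
    and repr: "\<And>u f. q u (e f) = blinfun_apply (T (\<kappa> u)) f"
  shows "linear \<kappa>"
proof -
  have lin: "linear T" using assms(1) by (simp add: linear_isometry_def)
  note inj = injD[OF linear_isometry_inj[OF assms(1)]]
  show ?thesis
    by (intro linearI inj blinfun_eqI)
      (simp_all add: linear_add[OF lin] linear_scale[OF lin] blinfun.bilinear_simps
        repr[symmetric] linear_add[OF assms(2)] linear_scale[OF assms(2)])
qed

theorem theorem3p3:
  fixes X :: "'x set" and \<Omega> :: "'w set"
    and pU :: "'v::banach \<Rightarrow> 'u::banach \<Rightarrow> real"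
    and evB :: "'b::banach \<Rightarrow> 'x \<Rightarrow> 'u"
    and evD :: "'d::banach \<Rightarrow> 'w \<Rightarrow> 'v"
  assumes "duality_pairing pU"
    and "vv_RKBS X evB"
    and "banach_function_space \<Omega> evD"
  shows
    "((\<exists>\<iota> :: 'd \<Rightarrow> ('b \<Rightarrow>\<^sub>L real). linear_isometry \<iota> \<and> separates_points \<iota>)
      \<longleftrightarrow>
      (\<exists>p :: 'd \<Rightarrow> 'b \<Rightarrow> real. duality_pairing p \<and> norm_is_dual_norm p))
     \<and>
     ((Delta X pU evB \<subseteq> range (blinfun_apply :: ('b \<Rightarrow>\<^sub>L real) \<Rightarrow> 'b \<Rightarrow> real) \<and>
       (\<exists>T :: 'd \<Rightarrow> ('b \<Rightarrow>\<^sub>L real). linear_isometry T \<and> range T = delta_dual X pU evB))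
      \<longleftrightarrow>
      (\<exists>p :: 'd \<Rightarrow> 'b \<Rightarrow> real. duality_pairing p \<and> norm_is_dual_norm p \<and>
        (\<exists>K :: 'x \<Rightarrow> 'w \<Rightarrow> 'v \<Rightarrow> 'v. (\<forall>x\<in>X. \<forall>w\<in>\<Omega>. linear (K x w)) \<and>
          (\<exists>k :: 'x \<Rightarrow> 'v \<Rightarrow> 'd.
            (\<forall>x\<in>X. \<forall>u. \<forall>w\<in>\<Omega>. evD (k x u) w = K x w u) \<and>
            (\<forall>x\<in>X. \<forall>u f. pU u (evB f x) = p (k x u) f) \<and>
            closure (span {k x u | x u. x \<in> X}) = UNIV))))"
proof (intro conjI iffI)
  assume "\<exists>\<iota> :: 'd \<Rightarrow> ('b \<Rightarrow>\<^sub>L real). linear_isometry \<iota> \<and> separates_points \<iota>"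
  then show "\<exists>p :: 'd \<Rightarrow> 'b \<Rightarrow> real. duality_pairing p \<and> norm_is_dual_norm p"
    using linear_isometry_imp_pairing by blast
next
  assume "\<exists>p :: 'd \<Rightarrow> 'b \<Rightarrow> real. duality_pairing p \<and> norm_is_dual_norm p"
  then show "\<exists>\<iota> :: 'd \<Rightarrow> ('b \<Rightarrow>\<^sub>L real). linear_isometry \<iota> \<and> separates_points \<iota>"
    using pairing_obtains_linear_isometry by metis
next
  assume "Delta X pU evB \<subseteq> range (blinfun_apply :: ('b \<Rightarrow>\<^sub>L real) \<Rightarrow> 'b \<Rightarrow> real) \<and>
       (\<exists>T :: 'd \<Rightarrow> ('b \<Rightarrow>\<^sub>L real). linear_isometry T \<and> range T = delta_dual X pU evB)"
  then obtain T :: "'d \<Rightarrow> ('b \<Rightarrow>\<^sub>L real)"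
    where sub: "Delta X pU evB \<subseteq> range (blinfun_apply :: ('b \<Rightarrow>\<^sub>L real) \<Rightarrow> 'b \<Rightarrow> real)"
      and iso: "linear_isometry T" and ran: "range T = delta_dual X pU evB"
    by blast
  \<comment> \<open>Each \<open>delta\<close> is continuous and lies in the closure of
    \<open>Delta\<close>, which is \<open>range T\<close>. Its preimage under \<open>T\<close>
    serves as the kernel section.\<close>
  have "\<exists>g. blinfun_apply (T g) = delta pU evB x u" if "x \<in> X" for x u
  proof -
    have mem: "delta pU evB x u \<in> Delta X pU evB"
      unfolding Delta_def using that
      by (intro module.span_base[OF module_real_functions]) blast
    with sub obtain \<phi> :: "'b \<Rightarrow>\<^sub>L real" where \<phi>: "delta pU evB x u = blinfun_apply \<phi>"
      by blast
    with mem have "\<phi> \<in> delta_dual X pU evB"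
      unfolding delta_dual_def by (intro subsetD[OF closure_subset]) simp
    then show ?thesis using ran \<phi> by (metis rangeE)
  qed
  then obtain k where "\<And>x u. x \<in> X \<Longrightarrow> blinfun_apply (T (k x u)) = delta pU evB x u"
    by metis
  then have repr: "pU u (evB f x) = blinfun_apply (T (k x u)) f" if "x \<in> X" for x u f
    using that by (simp add: delta_def)
  have ev_0: "evB 0 x = 0" if "x \<in> X" for x
    using assms(2) that linear_0 by (fastforce simp: vv_RKBS_def banach_function_space_def)
  \<comment> \<open>If all of \<open>range T\<close> vanishes at \<open>f\<close>, then so does
    every \<open>delta\<close>. Nondegeneracy of \<open>pU\<close> makes all values of
    \<open>f\<close> on \<open>X\<close> zero, and these values determine \<open>f\<close>.\<close>
  have "separates_points T"
    unfolding separates_points_def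
  proof (intro allI impI)
    fix f assume 0: "\<forall>g. blinfun_apply (T g) f = 0"
    have "evB f x = evB 0 x" if "x \<in> X" for x
      using repr[OF that] 0 assms(1) ev_0[OF that] by (metis duality_pairing_def)
    then show "f = 0"
      using assms(2) by (auto simp: vv_RKBS_def banach_function_space_def)
  qed
  note pairing = linear_isometry_imp_pairing[OF iso this]
  have lin: "linear (\<lambda>u. evD (k x u) w)" if "x \<in> X" "w \<in> \<Omega>" for x w
  proof -
    have "linear (k x)"
      using assms(1)
      by (intro linear_kernel_section[where e = "\<lambda>f. evB f x", OF iso _ repr[OF \<open>x \<in> X\<close>]])
        (auto simp: duality_pairing_def bilinear_def)
    moreover have "linear (\<lambda>g. evD g w)"
      using assms(3) \<open>w \<in> \<Omega>\<close> by (simp add: banach_function_space_def)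
    ultimately show ?thesis
      using linear_compose unfolding o_def by blast
  qed
  \<comment> \<open>Both sides equal the delta-dual; cancelling the injective \<open>T\<close> gives
    density.\<close>
  have "T ` closure (span {k x u | x u. x \<in> X}) = T ` UNIV"
    using delta_dual_eq_image_closure[of T X pU evB k, OF iso repr] ran by simp
  then have dense: "closure (span {k x u | x u. x \<in> X}) = UNIV"
    using linear_isometry_inj[OF iso] by (simp only: inj_image_eq_iff)
  show "\<exists>p :: 'd \<Rightarrow> 'b \<Rightarrow> real. duality_pairing p \<and> norm_is_dual_norm p \<and>
        (\<exists>K :: 'x \<Rightarrow> 'w \<Rightarrow> 'v \<Rightarrow> 'v. (\<forall>x\<in>X. \<forall>w\<in>\<Omega>. linear (K x w)) \<and>
          (\<exists>k :: 'x \<Rightarrow> 'v \<Rightarrow> 'd.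
            (\<forall>x\<in>X. \<forall>u. \<forall>w\<in>\<Omega>. evD (k x u) w = K x w u) \<and>
            (\<forall>x\<in>X. \<forall>u f. pU u (evB f x) = p (k x u) f) \<and>
            closure (span {k x u | x u. x \<in> X}) = UNIV))"
    \<comment> \<open>The operator \<open>K x w\<close> is read off from the values of the sections,
      so its compatibility with \<open>k\<close> is reflexivity.\<close>
    by (intro exI[of _ "\<lambda>g. blinfun_apply (T g)"] exI[of _ "\<lambda>x w u. evD (k x u) w"]
        exI[of _ k] conjI ballI allI pairing lin repr dense refl)
next
  assume "\<exists>p :: 'd \<Rightarrow> 'b \<Rightarrow> real. duality_pairing p \<and> norm_is_dual_norm p \<and>
        (\<exists>K :: 'x \<Rightarrow> 'w \<Rightarrow> 'v \<Rightarrow> 'v. (\<forall>x\<in>X. \<forall>w\<in>\<Omega>. linear (K x w)) \<and>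
          (\<exists>k :: 'x \<Rightarrow> 'v \<Rightarrow> 'd.
            (\<forall>x\<in>X. \<forall>u. \<forall>w\<in>\<Omega>. evD (k x u) w = K x w u) \<and>
            (\<forall>x\<in>X. \<forall>u f. pU u (evB f x) = p (k x u) f) \<and>
            closure (span {k x u | x u. x \<in> X}) = UNIV))"
  then obtain p :: "'d \<Rightarrow> 'b \<Rightarrow> real" and k :: "'x \<Rightarrow> 'v \<Rightarrow> 'd"
    where "duality_pairing p" and "norm_is_dual_norm p"
      and p: "\<And>x u f. x \<in> X \<Longrightarrow> pU u (evB f x) = p (k x u) f"
      and dense: "closure (span {k x u | x u. x \<in> X}) = UNIV"
    by blast
  then obtain T :: "'d \<Rightarrow> ('b \<Rightarrow>\<^sub>L real)"
    where iso: "linear_isometry T" and T: "\<And>g f. blinfun_apply (T g) f = p g f"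
    using pairing_obtains_linear_isometry by blast
  \<comment> \<open>In terms of \<open>T\<close> the reproducing property identifies
    \<open>T (k x u)\<close> with \<open>delta\<close>, as the span and closure lemmas
    require.\<close>
  have repr: "\<And>x u f. x \<in> X \<Longrightarrow> pU u (evB f x) = blinfun_apply (T (k x u)) f"
    by (simp add: p T)
  have "linear T" using iso by (simp add: linear_isometry_def)
  from Delta_eq_image_span[of T X pU evB k, OF this repr]
  show "Delta X pU evB \<subseteq> range (blinfun_apply :: ('b \<Rightarrow>\<^sub>L real) \<Rightarrow> 'b \<Rightarrow> real)"
    by auto
  have "range T = delta_dual X pU evB"
    using delta_dual_eq_image_closure[of T X pU evB k, OF iso repr] dense by simp
  with iso show "\<exists>T :: 'd \<Rightarrow> ('b \<Rightarrow>\<^sub>L real). linear_isometry T \<and> range T = delta_dual X pU evB"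
    by blast
qed

end
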